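(* Let $A\in\mathbb{R}^{m\times n}$, let $M\in\mathbb{R}^{n\times n}$ be symmetric positive definite, and let $b\in\mathbb{R}^m$ be nonzero. If the weighted Golub–Kahan bidiagonalization (WGKB) process of $A$ with weight matrix $M$ and starting vector $b$ terminates at step $k_t=\max\{i:\alpha_i\beta_i>0\}$, then the weighted LSQR iterate $x_{k_t}$ is the exact solution to $$\min_{x\in\mathcal{X}}\|x\|_M,\qquad \mathcal{X}=\Big\{x\in\mathbb{R}^n:\ \|Ax-b\|_2=\min_{z\in\mathbb{R}^n}\|Az-b\|_2\Big\}.$$
   Context: For $x\in\mathbb{R}^n$, $\|x\|_M:=(x^{\top}Mx)^{1/2}$. WGKB process: with $q_0:=\mathbf{0}$, vectors $p_i\in\mathbb{R}^m$, $q_i\in\mathbb{R}^n$ and scalars $\alpha_i,\beta_i\geq 0$ are generated for $i=1,2,\dots$ by $$\beta_1p_1=b,\qquad \alpha_iq_i=M^{-1}A^{\top}p_i-\beta_iq_{i-1},\qquad \beta_{i+1}p_{i+1}=Aq_i-\alpha_ip_i,$$ where $\beta_i$ is the $\|\cdot\|_2$-norm of the right-hand side defining $\beta_ip_i$ and $\alpha_i$ is the $\|\cdot\|_M$-norm of the right-hand side defining $\alpha_iq_i$, so that $\|p_i\|_2=1$ and $\|q_i\|_M=1$ as long as the coefficients are positive. The process stops the first time some $\beta_i$ or $\alpha_i$ vanishes (if $\beta_i=0$, then $p_i$ and $q_i$ are not generated and $\alpha_i$ is regarded as $0$). The termination step is $k_t:=\max\{i:\alpha_i\beta_i>0\}$,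 so that $\alpha_{k_t+1}\beta_{k_t+1}=0$; it is assumed that this index exists, i.e. $\alpha_1\beta_1>0$. Weighted LSQR (WLSQR) iterates: for $1\leq k\leq k_t$, let $Q_k=(q_1,\dots,q_k)\in\mathbb{R}^{n\times k}$ and let $B_k\in\mathbb{R}^{(k+1)\times k}$ be the lower bidiagonal matrix with $(B_k)_{ii}=\alpha_i$ and $(B_k)_{i+1,i}=\beta_{i+1}$ for $i=1,\dots,k$ and all other entries zero. Then $$x_k=Q_ky_k,\qquad y_k=B_k^{\dagger}\beta_1e_1,$$ where $e_1$ is the first column of $I_{k+1}$ and $\dagger$ denotes the Moore–Penrose pseudoinverse; equivalently $y_k$ minimizes $\|B_ky-\beta_1e_1\|_2$ over $y\in\mathbb{R}^k$. *)

theory Defs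
  imports Complex_Main "Jordan_Normal_Form.Gauss_Jordan_Elimination"
begin

definition sym_pos_def :: "nat \<Rightarrow> real mat \<Rightarrow> bool" where
  "sym_pos_def n M \<longleftrightarrow> M \<in> carrier_mat n n \<and> transpose_mat M = M \<and>
     (\<forall>x \<in> carrier_vec n. x \<noteq> 0\<^sub>v n \<longrightarrow> x \<bullet> (M *\<^sub>v x) > 0)"

definition norm2 :: "real vec \<Rightarrow> real" where
  "norm2 x = sqrt (x \<bullet> x)"

definition wnorm :: "real mat \<Rightarrow> real vec \<Rightarrow> real" where
  "wnorm M x = sqrt (x \<bullet> (M *\<^sub>v x))"

text \<open>The four Penrose conditions, for real matrices.\<close>

definition moore_penrose :: "real mat \<Rightarrow> real mat \<Rightarrow> bool" where
  "moore_penrose B X \<longleftrightarrow> X \<in> carrier_mat (dim_col B) (dim_row B) \<and>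
     B * X * B = B \<and> X * B * X = X \<and>
     transpose_mat (B * X) = B * X \<and> transpose_mat (X * B) = X * B"

definition pinv :: "real mat \<Rightarrow> real mat" where
  "pinv B = (THE X. moore_penrose B X)"

text \<open>The value of the process at step \<open>i\<close> is \<open>(\<beta>\<^sub>i, p\<^sub>i, \<alpha>\<^sub>i, q\<^sub>i)\<close>. Only \<open>q\<^sub>0 = 0\<close> is
  meaningful at step 0; \<open>\<beta>\<^sub>0\<close>, \<open>p\<^sub>0\<close> and \<open>\<alpha>\<^sub>0\<close> are dummies.

  The recursion continues past the stopping point, where \<open>1 / 0 = 0\<close> makes every quantity vanish:
  if \<open>\<beta>\<^sub>i = 0\<close>, then \<open>p\<^sub>i = 0\<close>, hence \<open>\<alpha>\<^sub>i = 0\<close> and \<open>q\<^sub>i = 0\<close>; if \<open>\<alpha>\<^sub>i = 0\<close> with \<open>i \<ge> 1\<close>, then \<open>q\<^sub>i = 0\<close>,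
  hence \<open>\<beta>\<close> vanishes at step \<open>i + 1\<close>. So no coefficient becomes positive again after the process
  has stopped.\<close>

primrec wgkb :: "real mat \<Rightarrow> real mat \<Rightarrow> real vec \<Rightarrow> nat
    \<Rightarrow> real \<times> real vec \<times> real \<times> real vec" where
  "wgkb A M b 0 = (0, 0\<^sub>v (dim_row A), 0, 0\<^sub>v (dim_col A))"
| "wgkb A M b (Suc i) =
    (let (\<beta>, p, \<alpha>, q) = wgkb A M b i;
         u = (if i = 0 then b else A *\<^sub>v q - \<alpha> \<cdot>\<^sub>v p);
         \<beta>' = norm2 u;
         p' = (1 / \<beta>') \<cdot>\<^sub>v u;
         v = the (mat_inverse M) *\<^sub>v (transpose_mat A *\<^sub>v p') - \<beta>' \<cdot>\<^sub>v q;
         \<alpha>' = wnorm M v;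
         q' = (1 / \<alpha>') \<cdot>\<^sub>v v
     in (\<beta>', p', \<alpha>', q'))"

definition wgkb_beta :: "real mat \<Rightarrow> real mat \<Rightarrow> real vec \<Rightarrow> nat \<Rightarrow> real" where
  "wgkb_beta A M b i = fst (wgkb A M b i)"

definition wgkb_alpha :: "real mat \<Rightarrow> real mat \<Rightarrow> real vec \<Rightarrow> nat \<Rightarrow> real" where
  "wgkb_alpha A M b i = fst (snd (snd (wgkb A M b i)))"

definition wgkb_q :: "real mat \<Rightarrow> real mat \<Rightarrow> real vec \<Rightarrow> nat \<Rightarrow> real vec" where
  "wgkb_q A M b i = snd (snd (snd (wgkb A M b i)))"

text \<open>\<open>k = max {i. \<alpha>\<^sub>i \<beta>\<^sub>i > 0}\<close>, including that this maximum exists.\<close>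

definition wgkb_terminates_at :: "real mat \<Rightarrow> real mat \<Rightarrow> real vec \<Rightarrow> nat \<Rightarrow> bool" where
  "wgkb_terminates_at A M b k \<longleftrightarrow>
     (let S = {i. 1 \<le> i \<and> wgkb_alpha A M b i * wgkb_beta A M b i > 0}
      in k \<in> S \<and> (\<forall>i \<in> S. i \<le> k))"

text \<open>Matrix and vector indices start at 0, those of the process at 1: column \<open>j\<close> of \<open>Q\<^sub>k\<close> is
  \<open>q\<close> at step \<open>j + 1\<close>, and column \<open>j\<close> of \<open>B\<^sub>k\<close> has \<open>\<alpha>\<close> of step \<open>j + 1\<close> on the diagonal and \<open>\<beta>\<close> of
  step \<open>j + 2\<close> below it.\<close>

definition Q_mat :: "real mat \<Rightarrow> real mat \<Rightarrow> real vec \<Rightarrow> nat \<Rightarrow> real mat" where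
  "Q_mat A M b k = mat_of_cols (dim_col A) (map (wgkb_q A M b) [1..<k + 1])"

definition B_mat :: "real mat \<Rightarrow> real mat \<Rightarrow> real vec \<Rightarrow> nat \<Rightarrow> real mat" where
  "B_mat A M b k = mat (k + 1) k (\<lambda>(i, j).
     if i = j then wgkb_alpha A M b (j + 1)
     else if i = j + 1 then wgkb_beta A M b (j + 2)
     else 0)"

definition wlsqr :: "real mat \<Rightarrow> real mat \<Rightarrow> real vec \<Rightarrow> nat \<Rightarrow> real vec" where
  "wlsqr A M b k =
     Q_mat A M b k *\<^sub>v (pinv (B_mat A M b k) *\<^sub>v (wgkb_beta A M b 1 \<cdot>\<^sub>v unit_vec (k + 1) 0))"

definition lsq_solutions :: "real mat \<Rightarrow> real vec \<Rightarrow> real vec set" where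
  "lsq_solutions A b =
     {x. is_arg_min (\<lambda>z. norm2 (A *\<^sub>v z - b)) (\<lambda>z. z \<in> carrier_vec (dim_col A)) x}"

end

theory Submission
  imports Defs "Jordan_Normal_Form.Determinant"
begin

text \<open>The recurrences give \<open>A Q\<^sub>k = P\<^sub>k\<^sub>+\<^sub>1 B\<^sub>k\<close> and, because \<open>\<alpha>\<^sub>k\<^sub>+\<^sub>1 q\<^sub>k\<^sub>+\<^sub>1 = 0\<close> at the terminating step,
  \<open>M\<^sup>-\<^sup>1 A\<^sup>T P\<^sub>k\<^sub>+\<^sub>1 = Q\<^sub>k B\<^sub>k\<^sup>T\<close>. As \<open>b = P\<^sub>k\<^sub>+\<^sub>1 \<beta>\<^sub>1 e\<^sub>1\<close>, the normal equations of the projected problem,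
  \<open>B\<^sub>k\<^sup>T (B\<^sub>k y\<^sub>k - \<beta>\<^sub>1 e\<^sub>1) = 0\<close>, yield those of the full one, \<open>A\<^sup>T (A x\<^sub>k - b) = 0\<close>. Moreover all \<open>q\<^sub>i\<close>
  lie in the range of \<open>M\<^sup>-\<^sup>1 A\<^sup>T\<close>, so \<open>x\<^sub>k\<close> is \<open>M\<close>-orthogonal to the kernel of \<open>A\<close>, and Pythagoras in
  the two norms finishes the proof. Orthogonality of the \<open>p\<^sub>i\<close> and the \<open>q\<^sub>i\<close> is never needed.\<close>

section \<open>Positive definite weights and minimal-norm least squares\<close>

lemma scalar_prod_self_nonneg: "(x :: real vec) \<bullet> x \<ge> 0"
  by (auto simp: scalar_prod_def intro: sum_nonneg)

lemma scalar_prod_self_eq_0_iff: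
  assumes "(x :: real vec) \<in> carrier_vec n"
  shows "x \<bullet> x = 0 \<longleftrightarrow> x = 0\<^sub>v n"
  using assms by (auto simp: scalar_prod_def sum_nonneg_eq_0_iff intro!: eq_vecI)

lemma mult_mat_vec_zero:
  fixes A :: "'a :: semiring_0 mat"
  assumes "A \<in> carrier_mat nr nc"
  shows "A *\<^sub>v 0\<^sub>v nc = 0\<^sub>v nr"
  using assms by (intro eq_vecI) auto

lemma sym_pos_def_nonneg:
  assumes "sym_pos_def n M" "x \<in> carrier_vec n"
  shows "x \<bullet> (M *\<^sub>v x) \<ge> 0"
proof (cases "x = 0\<^sub>v n")
  case True
  have "M \<in> carrier_mat n n" using assms by (simp add: sym_pos_def_def)
  then show ?thesis using True by (simp add: scalar_prod_left_zero[of _ n])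
next
  case False
  then show ?thesis using assms by (auto simp: sym_pos_def_def intro: less_imp_le)
qed

lemma sym_pos_def_eq_0:
  assumes "sym_pos_def n M" "x \<in> carrier_vec n" "x \<bullet> (M *\<^sub>v x) = 0"
  shows "x = 0\<^sub>v n"
  using assms by (auto simp: sym_pos_def_def)

lemma wnorm_eq_0:
  assumes "sym_pos_def n M" "x \<in> carrier_vec n" "wnorm M x = 0"
  shows "x = 0\<^sub>v n"
  using assms sym_pos_def_eq_0 by (auto simp: wnorm_def)

lemma norm2_eq_0:
  assumes "x \<in> carrier_vec n" "norm2 x = 0"
  shows "x = 0\<^sub>v n"
  using assms scalar_prod_self_eq_0_iff by (auto simp: norm2_def)

text \<open>A trivial kernel makes the determinant nonzero, so \<open>M\<close> is a unit of the
  matrix ring and \<open>mat_inverse M\<close> is not \<open>None\<close>. Applied below to the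
  weight and to the Gram matrix of \<open>B\<close>.\<close>

lemma mat_inverse_of_trivial_kernel:
  fixes M :: "'a :: field mat"
  assumes M: "M \<in> carrier_mat n n"
    and ker: "\<And>x. x \<in> carrier_vec n \<Longrightarrow> M *\<^sub>v x = 0\<^sub>v n \<Longrightarrow> x = 0\<^sub>v n"
  shows "the (mat_inverse M) \<in> carrier_mat n n" "M * the (mat_inverse M) = 1\<^sub>m n"
    "the (mat_inverse M) * M = 1\<^sub>m n"
proof -
  have "det M \<noteq> 0" using det_0_iff_vec_prod_zero_field[OF M] ker by blast
  then have "M \<in> Units (ring_mat TYPE('a) n ())" by (rule det_non_zero_imp_unit[OF M])
  then obtain N where "mat_inverse M = Some N"
    using mat_inverse(1)[OF M, where b = "()"] by (cases "mat_inverse M") auto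
  with mat_inverse(2)[OF M this]
  show "the (mat_inverse M) \<in> carrier_mat n n" "M * the (mat_inverse M) = 1\<^sub>m n"
    "the (mat_inverse M) * M = 1\<^sub>m n" by auto
qed

lemma sym_pos_def_inverse:
  assumes "sym_pos_def n M"
  shows "the (mat_inverse M) \<in> carrier_mat n n" "M * the (mat_inverse M) = 1\<^sub>m n"
proof -
  have "M \<in> carrier_mat n n" using assms by (simp add: sym_pos_def_def)
  moreover have "x = 0\<^sub>v n" if "x \<in> carrier_vec n" "M *\<^sub>v x = 0\<^sub>v n" for x
    using sym_pos_def_eq_0[OF assms that(1)] that by simp
  ultimately show "the (mat_inverse M) \<in> carrier_mat n n" "M * the (mat_inverse M) = 1\<^sub>m n" by (auto intro!: mat_inverse_of_trivial_kernel)
qed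

text \<open>Pythagoras for the form given by \<open>M\<close>: symmetry carries the vanishing of one
  cross term over to the other.\<close>

lemma quadratic_form_add_orthogonal:
  fixes M :: "real mat"
  assumes M: "M \<in> carrier_mat n n" "transpose_mat M = M"
    and x: "x \<in> carrier_vec n" and y: "y \<in> carrier_vec n" and orth: "x \<bullet> (M *\<^sub>v y) = 0"
  shows "(x + y) \<bullet> (M *\<^sub>v (x + y)) = x \<bullet> (M *\<^sub>v x) + y \<bullet> (M *\<^sub>v y)"
proof -
  have Mx: "M *\<^sub>v x \<in> carrier_vec n" and My: "M *\<^sub>v y \<in> carrier_vec n" using M x y by auto
  have "y \<bullet> (M *\<^sub>v x) = (M *\<^sub>v y) \<bullet> x"
    using transpose_vec_mult_scalar[OF M(1) x y] M(2) by simp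
  also have "\<dots> = 0" using orth comm_scalar_prod[OF x My] by simp
  finally show ?thesis
    using orth x y Mx My
    by (simp add: mult_add_distrib_mat_vec[OF M(1) x y] add_scalar_prod_distrib[of _ n]
        scalar_prod_add_distrib[of _ n])
qed

lemma scalar_prod_self_add_orthogonal:
  assumes "(x :: real vec) \<in> carrier_vec n" "y \<in> carrier_vec n" "x \<bullet> y = 0"
  shows "(x + y) \<bullet> (x + y) = x \<bullet> x + y \<bullet> y"
  using quadratic_form_add_orthogonal[of "1\<^sub>m n" n x y] assms by simp

section \<open>Least squares through the normal equations\<close>

text \<open>The residual \<open>r\<close> at \<open>x\<close> is orthogonal to the range of
  \<open>A\<close>, so the squared misfit at \<open>z\<close> exceeds the one at \<open>x\<close> by
  exactly \<open>g z\<close>, the squared norm of \<open>A (z - x)\<close>.\<close>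

lemma lsq_solutions_normal_eq:
  assumes A: "A \<in> carrier_mat m n" and b: "b \<in> carrier_vec m" and x: "x \<in> carrier_vec n"
    and normal: "transpose_mat A *\<^sub>v (A *\<^sub>v x - b) = 0\<^sub>v n"
  shows "lsq_solutions A b = {z \<in> carrier_vec n. A *\<^sub>v (z - x) = 0\<^sub>v m}"
proof -
  define r where "r = A *\<^sub>v x - b"
  have r: "r \<in> carrier_vec m" using A b x by (auto simp: r_def)
  define g where "g z = (A *\<^sub>v (z - x)) \<bullet> (A *\<^sub>v (z - x))" for z
  have norm: "norm2 (A *\<^sub>v z - b) = sqrt (r \<bullet> r + g z)" if z: "z \<in> carrier_vec n" for z
  proof -
    have d: "z - x \<in> carrier_vec n" and Ad: "A *\<^sub>v (z - x) \<in> carrier_vec m"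
      using A x z by auto
    have "A *\<^sub>v z - b = r + A *\<^sub>v (z - x)"
      using A b x z unfolding r_def mult_minus_distrib_mat_vec[OF A z x]
      by (intro eq_vecI) auto
    moreover have "r \<bullet> (A *\<^sub>v (z - x)) = 0"
      using transpose_vec_mult_scalar[OF A d r] normal d by (simp add: r_def)
    ultimately show ?thesis
      using scalar_prod_self_add_orthogonal[OF r Ad] by (simp add: norm2_def g_def)
  qed
  have g_nonneg: "g z \<ge> 0" for z by (simp add: g_def scalar_prod_self_nonneg)
  have gx: "g x = 0" using A x by (simp add: g_def mult_mat_vec_zero[OF A])
  have g_0: "g z = 0 \<longleftrightarrow> A *\<^sub>v (z - x) = 0\<^sub>v m" if "z \<in> carrier_vec n" for z
    using that A x scalar_prod_self_eq_0_iff[of "A *\<^sub>v (z - x)" m] by (simp add: g_def)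
  have iff: "is_arg_min (\<lambda>z. norm2 (A *\<^sub>v z - b)) (\<lambda>z. z \<in> carrier_vec n) z
      \<longleftrightarrow> z \<in> carrier_vec n \<and> g z = 0" for z
  proof
    assume *: "is_arg_min (\<lambda>z. norm2 (A *\<^sub>v z - b)) (\<lambda>z. z \<in> carrier_vec n) z"
    then have "\<not> norm2 (A *\<^sub>v x - b) < norm2 (A *\<^sub>v z - b)" and z: "z \<in> carrier_vec n"
      using x by (auto simp: is_arg_min_def)
    then have "g z \<le> 0" using norm[OF x] norm[OF z] gx by simp
    with z g_nonneg[of z] show "z \<in> carrier_vec n \<and> g z = 0" by simp
  next
    assume "z \<in> carrier_vec n \<and> g z = 0"
    with g_nonneg show "is_arg_min (\<lambda>z. norm2 (A *\<^sub>v z - b)) (\<lambda>z. z \<in> carrier_vec n) z"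
      by (simp add: is_arg_min_def norm not_less)
  qed
  have "lsq_solutions A b = {z. z \<in> carrier_vec n \<and> g z = 0}"
    unfolding lsq_solutions_def carrier_matD[OF A] iff ..
  then show ?thesis using g_0 by blast
qed

text \<open>A least squares solution is \<open>x + d\<close> with \<open>d\<close> in the kernel of
  \<open>A\<close>. By orthogonality its squared \<open>M\<close>-norm is that of \<open>x\<close>
  plus that of \<open>d\<close>, and definiteness forces \<open>d = 0\<close> at a
  minimizer.\<close>

lemma min_wnorm_lsq_iff:
  assumes A: "A \<in> carrier_mat m n" and M: "sym_pos_def n M"
    and b: "b \<in> carrier_vec m" and x: "x \<in> carrier_vec n"
    and normal: "transpose_mat A *\<^sub>v (A *\<^sub>v x - b) = 0\<^sub>v n"
    and orth: "\<And>d. d \<in> carrier_vec n \<Longrightarrow> A *\<^sub>v d = 0\<^sub>v m \<Longrightarrow> x \<bullet> (M *\<^sub>v d) = 0"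
  shows "is_arg_min (wnorm M) (\<lambda>z. z \<in> lsq_solutions A b) z \<longleftrightarrow> z = x"
proof -
  note lsq = lsq_solutions_normal_eq[OF A b x normal]
  have Mc: "M \<in> carrier_mat n n" "transpose_mat M = M" using M by (auto simp: sym_pos_def_def)
  have x_lsq: "x \<in> lsq_solutions A b" using x by (simp add: lsq mult_mat_vec_zero[OF A])
  have norm: "wnorm M y = sqrt (x \<bullet> (M *\<^sub>v x) + (y - x) \<bullet> (M *\<^sub>v (y - x)))"
    if "y \<in> lsq_solutions A b" for y
  proof -
    have d: "y - x \<in> carrier_vec n" and "A *\<^sub>v (y - x) = 0\<^sub>v m" using that x by (auto simp: lsq)
    then have "x \<bullet> (M *\<^sub>v (y - x)) = 0" by (rule orth)
    moreover have "y = x + (y - x)" using that x by (auto simp: lsq)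
    ultimately show ?thesis
      using quadratic_form_add_orthogonal[OF Mc x d] by (simp add: wnorm_def)
  qed
  show ?thesis
  proof
    assume *: "is_arg_min (wnorm M) (\<lambda>z. z \<in> lsq_solutions A b) z"
    then have z: "z \<in> lsq_solutions A b" and "wnorm M z \<le> wnorm M x"
      using x_lsq by (auto simp: is_arg_min_def not_less)
    then have "(z - x) \<bullet> (M *\<^sub>v (z - x)) \<le> 0" unfolding norm[OF z] by (simp add: wnorm_def)
    moreover have zc: "z \<in> carrier_vec n" using z by (simp add: lsq)
    moreover have d: "z - x \<in> carrier_vec n" using zc x by simp
    ultimately have "z - x = 0\<^sub>v n"
      using sym_pos_def_nonneg[OF M d] sym_pos_def_eq_0[OF M d] by linarith
    then have "(z - x) + x = x" using x by simp
    moreover have "(z - x) + x = z" using zc x by (intro eq_vecI) auto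
    ultimately show "z = x" by simp
  next
    assume "z = x"
    moreover have "wnorm M x \<le> wnorm M y" if "y \<in> lsq_solutions A b" for y
      using sym_pos_def_nonneg[OF M, of "y - x"] that x
      unfolding norm[OF that] by (simp add: wnorm_def lsq)
    ultimately show "is_arg_min (wnorm M) (\<lambda>z. z \<in> lsq_solutions A b) z"
      using x_lsq by (auto simp: is_arg_min_def not_less)
  qed
qed

section \<open>The pseudoinverse\<close>

text \<open>\<open>B X\<close> and \<open>B Y\<close> are both the orthogonal projection onto the
  range of \<open>B\<close>, and \<open>X B\<close> and \<open>Y B\<close> both the one onto its row
  space. Once these agree, \<open>X = X B X = Y B X = Y B Y = Y\<close>.\<close>

lemma moore_penrose_unique:
  assumes X: "moore_penrose B X" and Y: "moore_penrose B Y"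
  shows "X = Y"
proof -
  define r c where "r = dim_row B" and "c = dim_col B"
  have [simp]: "B \<in> carrier_mat r c" "X \<in> carrier_mat c r" "Y \<in> carrier_mat c r"
    using X Y by (auto simp: moore_penrose_def r_def c_def)
  have [simp]: "B * X \<in> carrier_mat r r" "B * Y \<in> carrier_mat r r"
    "X * B \<in> carrier_mat c c" "Y * B \<in> carrier_mat c c"
    by (auto intro: mult_carrier_mat[of _ r c] mult_carrier_mat[of _ c r])
  have BX: "B * X * B = B" "X * B * X = X" "transpose_mat (B * X) = B * X"
    "transpose_mat (X * B) = X * B"
    and BY: "B * Y * B = B" "Y * B * Y = Y" "transpose_mat (B * Y) = B * Y"
    "transpose_mat (Y * B) = Y * B"
    using X Y by (auto simp: moore_penrose_def)
  have "B * X = (B * Y * B) * X" using BY by simp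
  also have "\<dots> = (B * Y) * (B * X)" by (rule assoc_mult_mat[of _ r r _ c _ r]) auto
  \<comment> \<open>Symmetry of both factors lets transposition reverse the product, after which
    \<open>B X B = B\<close> absorbs \<open>X\<close>.\<close>
  also have "\<dots> = transpose_mat (B * Y) * transpose_mat (B * X)" using BX BY by simp
  also have "\<dots> = transpose_mat ((B * X) * (B * Y))"
    by (rule transpose_mult[symmetric, of _ r r _ r]) auto
  also have "(B * X) * (B * Y) = (B * X * B) * Y"
    by (rule assoc_mult_mat[symmetric, of _ r r _ c _ r]) auto
  also have "transpose_mat \<dots> = B * Y" using BX BY by simp
  finally have 1: "B * X = B * Y" .
  have "X * B = X * (B * Y * B)" using BY by simp
  also have "B * Y * B = B * (Y * B)" by (rule assoc_mult_mat[of _ r c _ r _ c]) auto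
  also have "X * \<dots> = (X * B) * (Y * B)"
    by (rule assoc_mult_mat[symmetric, of _ c r _ c _ c]) auto
  also have "\<dots> = transpose_mat (X * B) * transpose_mat (Y * B)" using BX BY by simp
  also have "\<dots> = transpose_mat ((Y * B) * (X * B))"
    by (rule transpose_mult[symmetric, of _ c c _ c]) auto
  also have "(Y * B) * (X * B) = Y * (B * (X * B))" by (rule assoc_mult_mat[of _ c r _ c _ c]) auto
  also have "B * (X * B) = B * X * B" by (rule assoc_mult_mat[symmetric, of _ r c _ r _ c]) auto
  also have "transpose_mat (Y * (B * X * B)) = Y * B" using BX BY by simp
  finally have 2: "X * B = Y * B" .
  have "X = X * B * X" using BX by simp
  also have "\<dots> = Y * (B * X)" unfolding 2 by (rule assoc_mult_mat[of _ c r _ c _ r]) auto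
  also have "\<dots> = Y * B * Y" unfolding 1 by (rule assoc_mult_mat[symmetric, of _ c r _ c _ r]) auto
  finally show ?thesis using BY by simp
qed

text \<open>With \<open>G = B^T B\<close> invertible and \<open>H = G^-1\<close>, the matrix
  \<open>X = H B^T\<close> is a left inverse of \<open>B\<close>. This settles every Penrose
  condition but the symmetry of \<open>B X = B H B^T\<close>, which follows from that of
  \<open>H\<close>.\<close>

lemma moore_penrose_full_col_rank:
  assumes B: "B \<in> carrier_mat r c"
    and inj: "\<And>y. y \<in> carrier_vec c \<Longrightarrow> B *\<^sub>v y = 0\<^sub>v r \<Longrightarrow> y = 0\<^sub>v c"
  shows "moore_penrose B (the (mat_inverse (transpose_mat B * B)) * transpose_mat B)"
proof -
  define G where "G = transpose_mat B * B"
  define H where "H = the (mat_inverse G)"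
  note [simp] = B
  have BT[simp]: "transpose_mat B \<in> carrier_mat c r" using B by simp
  have G[simp]: "G \<in> carrier_mat c c" by (auto simp: G_def intro: mult_carrier_mat[OF BT B])
  have "y = 0\<^sub>v c" if y: "y \<in> carrier_vec c" "G *\<^sub>v y = 0\<^sub>v c" for y
  proof -
    have By: "B *\<^sub>v y \<in> carrier_vec r" by (rule mult_mat_vec_carrier[OF B y(1)])
    have "(B *\<^sub>v y) \<bullet> (B *\<^sub>v y) = (transpose_mat B *\<^sub>v (B *\<^sub>v y)) \<bullet> y"
      using transpose_vec_mult_scalar[OF B y(1) By] by simp
    also have "transpose_mat B *\<^sub>v (B *\<^sub>v y) = G *\<^sub>v y"
      unfolding G_def using assoc_mult_mat_vec[OF BT B y(1)] by simp
    finally have "(B *\<^sub>v y) \<bullet> (B *\<^sub>v y) = 0" using y by simp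
    then show ?thesis using inj y By scalar_prod_self_eq_0_iff by blast
  qed
  note inv = mat_inverse_of_trivial_kernel[OF G this, folded H_def]
  have H[simp]: "H \<in> carrier_mat c c" and GH: "G * H = 1\<^sub>m c" and HG: "H * G = 1\<^sub>m c"
    using inv by auto
  have GT: "transpose_mat G = G"
    unfolding G_def using transpose_mult[OF BT B] by simp
  have HT: "transpose_mat H = H"
  proof -
    have "transpose_mat H * G = transpose_mat (G * H)"
      using transpose_mult[OF G H] GT by simp
    then have "transpose_mat H * G = 1\<^sub>m c" using GH by simp
    \<comment> \<open>Multiplying by \<open>H\<close> on the right cancels \<open>G\<close> and
      leaves \<open>H^T = H\<close>.\<close>
    then have "transpose_mat H * (G * H) = 1\<^sub>m c * H"
      using assoc_mult_mat[of "transpose_mat H" c c G c H c] by simp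
    then show ?thesis
      using GH left_mult_one_mat[OF H] right_mult_one_mat[of "transpose_mat H" c c] by simp
  qed
  define X where "X = H * transpose_mat B"
  have X[simp]: "X \<in> carrier_mat c r" unfolding X_def by (rule mult_carrier_mat[OF H BT])
  have XB: "X * B = 1\<^sub>m c"
    unfolding X_def using assoc_mult_mat[OF H BT B] HG G_def by simp
  have "transpose_mat X = B * H"
    unfolding X_def using transpose_mult[OF H BT] HT by simp
  then have "transpose_mat (B * X) = B * H * transpose_mat B"
    using transpose_mult[OF B X] by simp
  also have "\<dots> = B * X" unfolding X_def by (rule assoc_mult_mat[OF B H BT])
  finally have sym: "transpose_mat (B * X) = B * X" .
  have "B * X * B = B" using assoc_mult_mat[OF B X B] XB right_mult_one_mat[OF B] by simp
  moreover have "X * B * X = X" using XB left_mult_one_mat[OF X] by simp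
  moreover have "transpose_mat (X * B) = X * B" by (simp add: XB)
  ultimately have "moore_penrose B X"
    using sym X unfolding moore_penrose_def carrier_matD[OF B] by blast
  then show ?thesis by (simp add: X_def H_def G_def)
qed

text \<open>Symmetry of \<open>B X\<close> and \<open>B X B = B\<close> give
  \<open>B^T B X = B^T (B X)^T = (B X B)^T = B^T\<close>.\<close>

lemma moore_penrose_normal_eq:
  assumes B: "B \<in> carrier_mat r c" and X: "moore_penrose B X" and v: "v \<in> carrier_vec r"
  shows "transpose_mat B *\<^sub>v (B *\<^sub>v (X *\<^sub>v v) - v) = 0\<^sub>v c"
proof -
  have Xc: "X \<in> carrier_mat c r" and BXB: "B * X * B = B"
    and sym: "transpose_mat (B * X) = B * X"
    using X B by (auto simp: moore_penrose_def)
  have BT: "transpose_mat B \<in> carrier_mat c r" and BX: "B * X \<in> carrier_mat r r"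
    using B Xc by auto
  have "transpose_mat B * (B * X) = transpose_mat B * transpose_mat (B * X)" using sym by simp
  also have "\<dots> = transpose_mat (B * X * B)" using transpose_mult[OF BX B] by simp
  finally have eq: "transpose_mat B * (B * X) = transpose_mat B" using BXB by simp
  have "transpose_mat B *\<^sub>v (B *\<^sub>v (X *\<^sub>v v)) = (transpose_mat B * (B * X)) *\<^sub>v v"
    using assoc_mult_mat_vec[OF B Xc v] assoc_mult_mat_vec[OF BT BX v] by simp
  then have "transpose_mat B *\<^sub>v (B *\<^sub>v (X *\<^sub>v v)) = transpose_mat B *\<^sub>v v" using eq by simp
  moreover have "B *\<^sub>v (X *\<^sub>v v) \<in> carrier_vec r" using B Xc v by auto
  ultimately show ?thesis
    using mult_minus_distrib_mat_vec[OF BT _ v] BT v by simp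
qed

section \<open>The bidiagonalization process\<close>

text \<open>The left vectors become the columns of \<open>P_mat\<close> below.\<close>

definition wgkb_p :: "real mat \<Rightarrow> real mat \<Rightarrow> real vec \<Rightarrow> nat \<Rightarrow> real vec" where
  "wgkb_p A M b i = fst (snd (wgkb A M b i))"

locale wgkb_process =
  fixes A M :: "real mat" and b :: "real vec" and m n :: nat
  assumes A: "A \<in> carrier_mat m n" and M: "sym_pos_def n M" and b: "b \<in> carrier_vec m"
begin

abbreviation "\<alpha> \<equiv> wgkb_alpha A M b"
abbreviation "\<beta> \<equiv> wgkb_beta A M b"
abbreviation "p \<equiv> wgkb_p A M b"
abbreviation "q \<equiv> wgkb_q A M b"

definition "N = the (mat_inverse M)"
text \<open>\<open>u i\<close> and \<open>v i\<close> are the right-hand sides that step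
  \<open>i + 1\<close> normalises to \<open>p\<close> and \<open>q\<close>; their index is that of
  the preceding step.\<close>

definition "u i = (if i = 0 then b else A *\<^sub>v q i - \<alpha> i \<cdot>\<^sub>v p i)"
definition "v i = N *\<^sub>v (transpose_mat A *\<^sub>v p (Suc i)) - \<beta> (Suc i) \<cdot>\<^sub>v q i"

lemmas process_defs = wgkb_alpha_def wgkb_beta_def wgkb_p_def wgkb_q_def

lemma step:
  "\<beta> (Suc i) = norm2 (u i)" "p (Suc i) = (1 / \<beta> (Suc i)) \<cdot>\<^sub>v u i"
  "\<alpha> (Suc i) = wnorm M (v i)" "q (Suc i) = (1 / \<alpha> (Suc i)) \<cdot>\<^sub>v v i"
  unfolding u_def v_def N_def process_defs
  by (auto simp: Let_def split: prod.splits)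

lemma AT: "transpose_mat A \<in> carrier_mat n m"
  using A by simp

lemma Mc: "M \<in> carrier_mat n n" and MT: "transpose_mat M = M"
  using M by (auto simp: sym_pos_def_def)

lemma N: "N \<in> carrier_mat n n" and MN: "M * N = 1\<^sub>m n"
  using sym_pos_def_inverse[OF M] by (auto simp: N_def)

lemma carrier: "p i \<in> carrier_vec m \<and> q i \<in> carrier_vec n"
proof (induction i)
  case 0
  then show ?case using A by (simp add: process_defs)
next
  case (Suc i)
  then have "u i \<in> carrier_vec m" using A b by (auto simp: u_def)
  then have p: "p (Suc i) \<in> carrier_vec m" by (simp add: step)
  then have "v i \<in> carrier_vec n" using Suc AT N by (auto simp: v_def)
  with p show ?case by (simp add: step(4))
qed

lemma p: "p i \<in> carrier_vec m" and q: "q i \<in> carrier_vec n"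
  using carrier by auto

lemma u: "u i \<in> carrier_vec m" and v: "v i \<in> carrier_vec n"
  using A b p q AT N by (auto simp: u_def v_def)

lemma q_0: "q 0 = 0\<^sub>v n"
  using A by (simp add: process_defs)

text \<open>Normalisation can be undone even past the stopping point: a zero norm means
  \<open>u i = 0\<close>, so both sides vanish. The recurrence thus holds at every index.\<close>

lemma beta_p: "\<beta> (Suc i) \<cdot>\<^sub>v p (Suc i) = u i"
proof (cases "\<beta> (Suc i) = 0")
  case True
  then have "u i = 0\<^sub>v m" using norm2_eq_0[OF u] by (simp add: step(1))
  then show ?thesis using p[of "Suc i"] True by auto
next
  case False
  then show ?thesis by (simp add: step(2) smult_smult_assoc)
qed

text \<open>As for \<open>beta_p\<close>, with definiteness of \<open>M\<close> turning
  \<open>\<alpha> (Suc i) = 0\<close> into \<open>v i = 0\<close>.\<close>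

lemma alpha_q: "\<alpha> (Suc i) \<cdot>\<^sub>v q (Suc i) = v i"
proof (cases "\<alpha> (Suc i) = 0")
  case True
  then have "v i = 0\<^sub>v n" using wnorm_eq_0[OF M v] by (simp add: step(3))
  then show ?thesis using q[of "Suc i"] True by auto
next
  case False
  then show ?thesis by (simp add: step(4) smult_smult_assoc)
qed

lemma alpha_nonneg: "\<alpha> (Suc i) \<ge> 0" and beta_nonneg: "\<beta> (Suc i) \<ge> 0"
  using sym_pos_def_nonneg[OF M v] scalar_prod_self_nonneg
  by (auto simp: step(1,3) wnorm_def norm2_def)

lemma wnorm_0: "wnorm M (0\<^sub>v n) = 0"
  using Mc by (simp add: wnorm_def scalar_prod_left_zero[of _ n])

text \<open>Reduces the stopping condition, which concerns the product of \<alpha> and \<beta>, to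
  one on \<alpha> alone.\<close>

lemma beta_0_imp_alpha_0:
  assumes "\<beta> (Suc i) = 0"
  shows "\<alpha> (Suc i) = 0"
proof -
  have "p (Suc i) = 0\<^sub>v m" using assms u[of i] by (auto simp: step(2))
  then have "v i = 0\<^sub>v n"
    using assms q[of i] mult_mat_vec_zero[OF AT] mult_mat_vec_zero[OF N] by (auto simp: v_def)
  then show ?thesis by (simp add: step(3) wnorm_0)
qed

lemma alpha_0_Suc:
  assumes "\<alpha> (Suc i) = 0"
  shows "\<alpha> (Suc (Suc i)) = 0"
proof -
  have "q (Suc i) = 0\<^sub>v n" using assms v[of i] by (auto simp: step(4))
  then have "u (Suc i) = 0\<^sub>v m" using assms p[of "Suc i"] A by (auto simp: u_def)
  then have "\<beta> (Suc (Suc i)) = 0" by (simp add: step(1) norm2_def)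
  then show ?thesis by (rule beta_0_imp_alpha_0)
qed

text \<open>Once \<alpha> vanishes it stays zero, so \<open>\<alpha> k\<close> being nonzero keeps
  the whole diagonal of \<open>B_mat\<close> nonzero. Index 0 is excluded because
  \<open>\<alpha> 0 = 0\<close> is a dummy.\<close>

lemma alpha_nonzero_before:
  assumes "\<alpha> k \<noteq> 0" "1 \<le> i" "i \<le> k"
  shows "\<alpha> i \<noteq> 0"
proof
  assume "\<alpha> i = 0"
  with \<open>i \<le> k\<close> have "\<alpha> k = 0"
  proof (induction rule: dec_induct)
    case (step j)
    \<comment> \<open>\<open>alpha_0_Suc\<close> speaks of successors, hence the shift to
      \<open>j - 1\<close>, which is legitimate since \<open>1 \<le> i \<le> j\<close>.\<close>
    then show ?case using alpha_0_Suc[of "j - 1"] \<open>1 \<le> i\<close> by simp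
  qed
  with assms show False by simp
qed

section \<open>The recurrences and the kernel of \<open>A\<close>\<close>

lemma A_q: "A *\<^sub>v q (Suc i) = \<alpha> (Suc i) \<cdot>\<^sub>v p (Suc i) + \<beta> (Suc (Suc i)) \<cdot>\<^sub>v p (Suc (Suc i))"
  using beta_p[of "Suc i"] A p[of "Suc i"] q[of "Suc i"] by (auto simp: u_def)

lemma NAT_p: "N *\<^sub>v (transpose_mat A *\<^sub>v p (Suc i)) = \<alpha> (Suc i) \<cdot>\<^sub>v q (Suc i) + \<beta> (Suc i) \<cdot>\<^sub>v q i"
  using alpha_q[of i] AT N p[of "Suc i"] q[of i] by (auto simp: v_def)

lemma M_N_cancel:
  assumes "x \<in> carrier_vec n"
  shows "M *\<^sub>v (N *\<^sub>v x) = x"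
  using assoc_mult_mat_vec[OF Mc N assms] MN assms by simp

text \<open>\<open>q (Suc i)\<close> is a multiple of \<open>N A^T p - \<beta> q\<close>, whose
  second term is covered by induction. In the first, \<open>M\<close> cancels \<open>N\<close> and
  \<open>A^T\<close> moves over to \<open>d\<close>, leaving the product of \<open>p\<close> with
  \<open>A d = 0\<close>.\<close>

lemma q_orthogonal_kernel:
  assumes d: "d \<in> carrier_vec n" "A *\<^sub>v d = 0\<^sub>v m"
  shows "q i \<bullet> (M *\<^sub>v d) = 0"
proof (induction i)
  case 0
  have "M *\<^sub>v d \<in> carrier_vec n" using Mc d by auto
  then show ?case by (simp add: q_0)
next
  case (Suc i)
  define w where "w = transpose_mat A *\<^sub>v p (Suc i)"
  have w: "w \<in> carrier_vec n" and Nw: "N *\<^sub>v w \<in> carrier_vec n" and Md: "M *\<^sub>v d \<in> carrier_vec n"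
    using AT p N Mc d by (auto simp: w_def)
  have "(N *\<^sub>v w) \<bullet> (M *\<^sub>v d) = (M *\<^sub>v (N *\<^sub>v w)) \<bullet> d"
    using transpose_vec_mult_scalar[OF Mc d(1) Nw] MT by simp
  also have "\<dots> = p (Suc i) \<bullet> (A *\<^sub>v d)"
    unfolding M_N_cancel[OF w] unfolding w_def by (rule transpose_vec_mult_scalar[OF A d(1) p])
  also have "\<dots> = 0" using d p[of "Suc i"] by simp
  finally have "v i \<bullet> (M *\<^sub>v d) = 0"
    using Suc Nw Md q[of i]
    by (simp add: v_def flip: w_def) (simp add: minus_scalar_prod_distrib[of _ n])
  then show ?case using v[of i] Md by (simp add: step(4))
qed

section \<open>Matrix form of the recurrences\<close>

text \<open>One column more than \<open>Q_mat\<close>, to match the extra row of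
  \<open>B_mat\<close>; if \<open>\<beta> (Suc k) = 0\<close>, the last column is the zero
  vector.\<close>

definition "P_mat k = mat_of_cols m (map p [1..<k + 2])"

lemma P_mat: "P_mat k \<in> carrier_mat m (k + 1)"
  unfolding P_mat_def using mat_of_cols_carrier(1)[of m "map p [1..<k + 2]"] by (simp del: upt_Suc)

lemma P_mat_index: "r < m \<Longrightarrow> i < k + 1 \<Longrightarrow> P_mat k $$ (r, i) = p (Suc i) $ r"
  by (simp add: P_mat_def mat_of_cols_index del: upt_Suc)

lemma Q_mat: "Q_mat A M b k \<in> carrier_mat n k"
  unfolding Q_mat_def carrier_matD[OF A]
  using mat_of_cols_carrier(1)[of n "map q [1..<k + 1]"] by (simp del: upt_Suc)

lemma Q_mat_index: "r < n \<Longrightarrow> j < k \<Longrightarrow> Q_mat A M b k $$ (r, j) = q (Suc j) $ r"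
  using A by (simp add: Q_mat_def mat_of_cols_index del: upt_Suc)

lemma col_P_mat: "i < k + 1 \<Longrightarrow> col (P_mat k) i = p (Suc i)"
  using P_mat[of k] p[of "Suc i"] by (intro eq_vecI) (auto simp: P_mat_index)

lemma col_Q_mat: "j < k \<Longrightarrow> col (Q_mat A M b k) j = q (Suc j)"
  using Q_mat[of k] q[of "Suc j"] by (intro eq_vecI) (auto simp: Q_mat_index)

lemma B_mat: "B_mat A M b k \<in> carrier_mat (k + 1) k"
  by (simp add: B_mat_def)

text \<open>The two tests in \<open>B_mat\<close> exclude each other, so the entry is a sum of two
  Kronecker deltas; sums along a row or a column then split and collapse.\<close>

lemma B_mat_index:
  "i < k + 1 \<Longrightarrow> j < k \<Longrightarrow> B_mat A M b k $$ (i, j) =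
    (if i = j then \<alpha> (Suc j) else 0) + (if i = Suc j then \<beta> (Suc (Suc j)) else 0)"
  by (simp add: B_mat_def)

text \<open>Column \<open>j\<close> is \<open>A_q\<close>. Both \<open>j\<close> and
  \<open>Suc j\<close> are row indices of \<open>B_mat\<close>, so no boundary term is lost and the
  identity holds at every step.\<close>

lemma A_Q_mat: "A * Q_mat A M b k = P_mat k * B_mat A M b k"
proof (rule eq_matI)
  fix r j
  assume "r < dim_row (P_mat k * B_mat A M b k)" "j < dim_col (P_mat k * B_mat A M b k)"
  then have r: "r < m" and j: "j < k" using P_mat[of k] B_mat[of k] by auto
  have "(P_mat k * B_mat A M b k) $$ (r, j)
      = (\<Sum>i = 0..<k + 1. P_mat k $$ (r, i) * B_mat A M b k $$ (i, j))"
    using r j P_mat[of k] B_mat[of k] by (auto simp: scalar_prod_def)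
  also have "\<dots> = (\<Sum>i = 0..<k + 1. (if i = j then \<alpha> (Suc j) * p (Suc i) $ r else 0) +
      (if i = Suc j then \<beta> (Suc (Suc j)) * p (Suc i) $ r else 0))"
    using r j by (intro sum.cong) (auto simp: P_mat_index B_mat_index)
  also have "\<dots> = \<alpha> (Suc j) * p (Suc j) $ r + \<beta> (Suc (Suc j)) * p (Suc (Suc j)) $ r"
    using j by (simp add: sum.distrib)
  also have "\<dots> = (A *\<^sub>v q (Suc j)) $ r"
    using r p[of "Suc j"] p[of "Suc (Suc j)"] by (simp add: A_q)
  also have "\<dots> = (A * Q_mat A M b k) $$ (r, j)"
    using r j A Q_mat[of k] by (simp add: col_Q_mat)
  finally show "(A * Q_mat A M b k) $$ (r, j) = (P_mat k * B_mat A M b k) $$ (r, j)" by simp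
qed (use A P_mat[of k] Q_mat[of k] B_mat[of k] in auto)

text \<open>Column \<open>i\<close> is \<open>NAT_p\<close>. For \<open>i = k\<close> that
  recurrence involves \<open>q (Suc k)\<close>, which is not a column of \<open>Q_mat\<close>; the
  assumption removes this term.\<close>

lemma NAT_P_mat:
  assumes "\<alpha> (Suc k) = 0"
  shows "N * transpose_mat A * P_mat k = Q_mat A M b k * transpose_mat (B_mat A M b k)"
proof (rule eq_matI)
  fix r i
  assume "r < dim_row (Q_mat A M b k * transpose_mat (B_mat A M b k))"
    "i < dim_col (Q_mat A M b k * transpose_mat (B_mat A M b k))"
  then have r: "r < n" and i: "i < k + 1" using Q_mat[of k] B_mat[of k] by auto
  have "(Q_mat A M b k * transpose_mat (B_mat A M b k)) $$ (r, i)
      = (\<Sum>j = 0..<k. Q_mat A M b k $$ (r, j) * B_mat A M b k $$ (i, j))"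
    using r i Q_mat[of k] B_mat[of k] by (auto simp: scalar_prod_def)
  also have "\<dots> = (\<Sum>j = 0..<k. (if j = i then \<alpha> (Suc i) * q (Suc j) $ r else 0) +
      (if i = Suc j then \<beta> (Suc i) * q (Suc j) $ r else 0))"
    using r i by (intro sum.cong) (auto simp: Q_mat_index B_mat_index)
  \<comment> \<open>Two terms on the right can be absent from the sum: the \<beta> term for
    \<open>i = 0\<close>, where \<open>q 0 = 0\<close>, and the \<alpha> term for
    \<open>i = k\<close>, where \<open>\<alpha> (Suc k) = 0\<close>.\<close>
  also have "\<dots> = \<alpha> (Suc i) * q (Suc i) $ r + \<beta> (Suc i) * q i $ r"
  proof (cases i)
    case 0
    then show ?thesis using r assms by (cases k) (auto simp: sum.distrib q_0)
  next
    case (Suc i')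
    then show ?thesis using r i assms by (cases "i = k") (auto simp: sum.distrib)
  qed
  also have "\<dots> = (N *\<^sub>v (transpose_mat A *\<^sub>v p (Suc i))) $ r"
    using r q[of i] q[of "Suc i"] by (simp add: NAT_p)
  also have "\<dots> = (N * transpose_mat A *\<^sub>v p (Suc i)) $ r"
    using assoc_mult_mat_vec[OF N AT p[of "Suc i"]] by simp
  also have "\<dots> = (N * transpose_mat A * P_mat k) $$ (r, i)"
    using r i N P_mat[of k] by (simp add: col_P_mat)
  finally show "(N * transpose_mat A * P_mat k) $$ (r, i)
      = (Q_mat A M b k * transpose_mat (B_mat A M b k)) $$ (r, i)" by simp
qed (use N P_mat[of k] Q_mat[of k] B_mat[of k] in auto)

section \<open>The projected problem and termination\<close>

text \<open>The top \<open>k\<close> rows form a lower triangular matrix with nonzero diagonal, so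
  forward substitution applies.\<close>

lemma B_mat_injective:
  assumes "\<alpha> k \<noteq> 0" and y: "y \<in> carrier_vec k" and By: "B_mat A M b k *\<^sub>v y = 0\<^sub>v (k + 1)"
  shows "y = 0\<^sub>v k"
proof -
  have "y $ i = 0" if "i < k" for i
    using that
  proof (induction i)
    case 0
    have "0 = (B_mat A M b k *\<^sub>v y) $ 0" using By by simp
    also have "\<dots> = (\<Sum>j = 0..<k. B_mat A M b k $$ (0, j) * y $ j)"
      using y B_mat[of k] by (auto simp: scalar_prod_def)
    also have "\<dots> = (\<Sum>j = 0..<k. if j = 0 then \<alpha> 1 * y $ 0 else 0)"
      by (intro sum.cong) (auto simp: B_mat_index)
    also have "\<dots> = \<alpha> 1 * y $ 0" using 0 by simp
    finally show ?case using alpha_nonzero_before[OF assms(1), of 1] 0 by simp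
  next
    case (Suc i)
    have "0 = (B_mat A M b k *\<^sub>v y) $ Suc i" using By Suc.prems by simp
    also have "\<dots> = (\<Sum>j = 0..<k. B_mat A M b k $$ (Suc i, j) * y $ j)"
      using y B_mat[of k] Suc.prems by (auto simp: scalar_prod_def)
    \<comment> \<open>The subdiagonal term contains \<open>y $ i\<close>, which is zero by the
      induction hypothesis.\<close>
    also have "\<dots> = (\<Sum>j = 0..<k. if j = Suc i then \<alpha> (Suc (Suc i)) * y $ Suc i else 0)"
      using Suc by (intro sum.cong) (auto simp: B_mat_index)
    also have "\<dots> = \<alpha> (Suc (Suc i)) * y $ Suc i" using Suc.prems by simp
    finally show ?case
      using alpha_nonzero_before[OF assms(1), of "Suc (Suc i)"] Suc.prems by simp
  qed
  then show ?thesis using y by (intro eq_vecI) auto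
qed

text \<open>Full column rank gives existence; together with uniqueness, the \<open>THE\<close> in
  \<open>pinv\<close> is well defined.\<close>

lemma moore_penrose_pinv_B_mat:
  assumes "\<alpha> k \<noteq> 0"
  shows "moore_penrose (B_mat A M b k) (pinv (B_mat A M b k))"
proof -
  obtain X where X: "moore_penrose (B_mat A M b k) X"
    using moore_penrose_full_col_rank[OF B_mat B_mat_injective[OF assms]] by blast
  show ?thesis unfolding pinv_def by (rule theI, rule X, erule moore_penrose_unique[OF _ X])
qed

text \<open>Maximality excludes \<open>Suc k\<close>, so by nonnegativity one of the two
  coefficients vanishes there; if it is \<beta>, then \<alpha> vanishes as well.\<close>

lemma terminates_atD:
  assumes "wgkb_terminates_at A M b k"
  shows "\<alpha> k \<noteq> 0" "\<alpha> (Suc k) = 0"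
proof -
  show "\<alpha> k \<noteq> 0" using assms by (auto simp: wgkb_terminates_at_def)
  have "\<not> \<alpha> (Suc k) * \<beta> (Suc k) > 0"
    using assms unfolding wgkb_terminates_at_def Let_def by force
  then show "\<alpha> (Suc k) = 0"
    using alpha_nonneg[of k] beta_nonneg[of k] beta_0_imp_alpha_0[of k]
    by (metis less_eq_real_def mult_pos_pos)
qed

lemma P_mat_start: "P_mat k *\<^sub>v (\<beta> 1 \<cdot>\<^sub>v unit_vec (k + 1) 0) = b"
proof -
  have "P_mat k *\<^sub>v (\<beta> 1 \<cdot>\<^sub>v unit_vec (k + 1) 0) = \<beta> 1 \<cdot>\<^sub>v (P_mat k *\<^sub>v unit_vec (k + 1) 0)"
    by (rule mult_mat_vec[OF P_mat]) simp
  also have "P_mat k *\<^sub>v unit_vec (k + 1) 0 = p 1"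
    using P_mat[of k] col_P_mat[of 0 k] p[of 1]
    by (intro eq_vecI) (auto simp: P_mat_index scalar_prod_right_unit)
  finally show ?thesis using beta_p[of 0] by (simp add: u_def)
qed

section \<open>Optimality of the final iterate\<close>

lemma wlsqr_normal_eq:
  assumes "wgkb_terminates_at A M b k"
  shows "transpose_mat A *\<^sub>v (A *\<^sub>v wlsqr A M b k - b) = 0\<^sub>v n"
proof -
  note at_k = terminates_atD[OF assms]
  define B Q P where "B = B_mat A M b k" and "Q = Q_mat A M b k" and "P = P_mat k"
  define e y where "e = \<beta> 1 \<cdot>\<^sub>v unit_vec (k + 1) 0" and "y = pinv B *\<^sub>v e"
  note mp = moore_penrose_pinv_B_mat[OF at_k(1), folded B_def]
  have e: "e \<in> carrier_vec (k + 1)" by (simp add: e_def)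
  have Bc: "B \<in> carrier_mat (k + 1) k" and Qc: "Q \<in> carrier_mat n k" and Pc: "P \<in> carrier_mat m (k + 1)"
    using B_mat Q_mat P_mat by (auto simp: B_def Q_def P_def)
  have "pinv B \<in> carrier_mat k (k + 1)" using mp Bc by (auto simp: moore_penrose_def)
  then have y: "y \<in> carrier_vec k" using e by (auto simp: y_def)
  \<comment> \<open>The residual of the projected problem, which \<open>P\<close> maps to that of
    the full one.\<close>
  define s where "s = B *\<^sub>v y - e"
  have s: "s \<in> carrier_vec (k + 1)" using Bc y e by (auto simp: s_def)
  have BTs: "transpose_mat B *\<^sub>v s = 0\<^sub>v k"
    unfolding s_def y_def by (rule moore_penrose_normal_eq[OF Bc mp e])
  have "A *\<^sub>v (Q *\<^sub>v y) = P *\<^sub>v (B *\<^sub>v y)"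
    using assoc_mult_mat_vec[OF A Qc y] assoc_mult_mat_vec[OF Pc Bc y] A_Q_mat[of k]
    by (simp add: B_def Q_def P_def)
  moreover have "P *\<^sub>v e = b" using P_mat_start by (simp add: P_def e_def)
  moreover have "wlsqr A M b k = Q *\<^sub>v y" by (simp add: wlsqr_def Q_def y_def B_def e_def)
  ultimately have res: "A *\<^sub>v wlsqr A M b k - b = P *\<^sub>v s"
    using mult_minus_distrib_mat_vec[OF Pc _ e, of "B *\<^sub>v y"] Bc y by (simp add: s_def)
  have Ps: "P *\<^sub>v s \<in> carrier_vec m" using Pc s by auto
  have NAT: "N * transpose_mat A \<in> carrier_mat n m" using N AT by auto
  have BT: "transpose_mat B \<in> carrier_mat k (k + 1)" using Bc by simp
  have "N *\<^sub>v (transpose_mat A *\<^sub>v (P *\<^sub>v s)) = (N * transpose_mat A * P) *\<^sub>v s"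
    using assoc_mult_mat_vec[OF N AT Ps] assoc_mult_mat_vec[OF NAT Pc s] by simp
  also have "\<dots> = Q *\<^sub>v (transpose_mat B *\<^sub>v s)"
    using NAT_P_mat[OF at_k(2)] assoc_mult_mat_vec[OF Qc BT s] by (simp add: B_def Q_def P_def)
  also have "\<dots> = 0\<^sub>v n" using Qc by (auto simp: BTs)
  \<comment> \<open>\<open>NAT_P_mat\<close> controls \<open>N A^T\<close> rather than
    \<open>A^T\<close>; applying \<open>M\<close> undoes \<open>N\<close>.\<close>
  finally have "M *\<^sub>v (N *\<^sub>v (transpose_mat A *\<^sub>v (P *\<^sub>v s))) = 0\<^sub>v n" using Mc by auto
  moreover have "transpose_mat A *\<^sub>v (P *\<^sub>v s) \<in> carrier_vec n" using AT Ps by auto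
  ultimately show ?thesis unfolding res by (simp add: M_N_cancel)
qed

text \<open>Orthogonality passes from the columns to their span, since \<open>Q^T (M d)\<close>
  vanishes entry by entry.\<close>

lemma range_Q_mat_orthogonal_kernel:
  assumes y: "y \<in> carrier_vec k" and d: "d \<in> carrier_vec n" "A *\<^sub>v d = 0\<^sub>v m"
  shows "(Q_mat A M b k *\<^sub>v y) \<bullet> (M *\<^sub>v d) = 0"
proof -
  have Md: "M *\<^sub>v d \<in> carrier_vec n" using Mc d by auto
  have Qy: "Q_mat A M b k *\<^sub>v y \<in> carrier_vec n" by (rule mult_mat_vec_carrier[OF Q_mat y])
  have "transpose_mat (Q_mat A M b k) *\<^sub>v (M *\<^sub>v d) = 0\<^sub>v k"
    using Q_mat[of k] by (intro eq_vecI) (auto simp: col_Q_mat q_orthogonal_kernel[OF d])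
  then show ?thesis
    using transpose_vec_mult_scalar[OF Q_mat y Md] comm_scalar_prod[OF Md Qy] y by simp
qed

text \<open>\<open>pinv\<close> is a \<open>THE\<close> term, so its dimensions are read off the
  Penrose conditions, which is where \<open>\<alpha> k\<close> being nonzero enters.\<close>

lemma wlsqr_range_Q_mat:
  assumes "\<alpha> k \<noteq> 0"
  obtains y where "y \<in> carrier_vec k" "wlsqr A M b k = Q_mat A M b k *\<^sub>v y"
proof
  have "pinv (B_mat A M b k) \<in> carrier_mat k (k + 1)"
    using moore_penrose_pinv_B_mat[OF assms] B_mat[of k] by (auto simp: moore_penrose_def)
  then show "pinv (B_mat A M b k) *\<^sub>v (\<beta> 1 \<cdot>\<^sub>v unit_vec (k + 1) 0) \<in> carrier_vec k" by auto
qed (simp add: wlsqr_def)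

end

text \<open>The equivalence captures existence and uniqueness of the minimizer at once.\<close>

theorem theorem4p1:
  fixes A M :: "real mat" and b :: "real vec" and m n k\<^sub>t :: nat
  assumes "A \<in> carrier_mat m n"
    and "sym_pos_def n M"
    and "b \<in> carrier_vec m" and "b \<noteq> 0\<^sub>v m"
    and "wgkb_terminates_at A M b k\<^sub>t"
  shows "\<forall>x. is_arg_min (wnorm M) (\<lambda>z. z \<in> lsq_solutions A b) x \<longleftrightarrow> x = wlsqr A M b k\<^sub>t"
proof -
  interpret wgkb_process A M b m n
    using assms(1-3) by unfold_locales
  obtain y where y: "y \<in> carrier_vec k\<^sub>t" and x: "wlsqr A M b k\<^sub>t = Q_mat A M b k\<^sub>t *\<^sub>v y"
    using wlsqr_range_Q_mat[OF terminates_atD(1)[OF assms(5)]] .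
  have "wlsqr A M b k\<^sub>t \<in> carrier_vec n" unfolding x by (rule mult_mat_vec_carrier[OF Q_mat y])
  then show ?thesis
    using min_wnorm_lsq_iff[OF assms(1-3)] wlsqr_normal_eq[OF assms(5)]
      range_Q_mat_orthogonal_kernel[OF y, folded x] by blast
qed

end
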